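(* A finite binary word is a factor of $\mathbf{b}$ if and only if it does not contain $00$ (two consecutive $0$'s) as a factor.
   Context: Define finite binary words $B_i$ by $B_1 = 101$ and $B_{i+1} = B_i C_i$ for $i \geq 1$, where $C_i$ is the word obtained from $B_i$ by removing its first $i$ symbols. Since each $B_i$ is a prefix of $B_{i+1}$, there is a unique infinite binary word $\mathbf{b}$ of which every $B_i$ is a prefix. A factor is a contiguous subword. *)

theory Defs
  imports "HOL-Library.Z2" "HOL-Library.Sublist" "HOL-Library.Stream"
begin

text \<open>Indices start at 1, so the value at 0 is irrelevant. The word
  \<open>C\<^sub>i\<close> is \<open>drop i (B_word i)\<close>; by \<open>length_B_ge\<close> there are always at least
  \<open>i\<close> symbols to remove.\<close>

fun B_word :: "nat \<Rightarrow> bit list" where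
  "B_word 0 = []"
| "B_word (Suc 0) = [1, 0, 1]"
| "B_word (Suc (Suc n)) = B_word (Suc n) @ drop (Suc n) (B_word (Suc n))"

definition C_word :: "nat \<Rightarrow> bit list" where
  "C_word i = drop i (B_word i)"

definition inf_prefix :: "'a list \<Rightarrow> 'a stream \<Rightarrow> bool" where
  "inf_prefix w x \<longleftrightarrow> (\<exists>y. x = w @- y)"

definition inf_factor :: "'a list \<Rightarrow> 'a stream \<Rightarrow> bool" where
  "inf_factor w x \<longleftrightarrow> (\<exists>u y. x = u @- w @- y)"

text \<open>The description is well-defined by \<open>ex1_b_word\<close>.\<close>

definition b_word :: "bit stream" where
  "b_word = (THE x. \<forall>i\<ge>1. inf_prefix (B_word i) x)"

lemma B_step: "i \<ge> 1 \<Longrightarrow> B_word (i + 1) = B_word i @ C_word i"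
  by (cases i) (auto simp: C_word_def)

lemma length_B_ge: "i \<ge> 1 \<Longrightarrow> i + 2 \<le> length (B_word i)"
proof (induction i rule: nat_induct_at_least)
  case base
  then show ?case by simp
next
  case (Suc i)
  then show ?case using B_step[of i] by (simp add: C_word_def)
qed

lemma prefix_B:
  assumes "1 \<le> i" "i \<le> j"
  shows "prefix (B_word i) (B_word j)"
  using assms(2)
proof (induction j rule: dec_induct)
  case base
  then show ?case by simp
next
  case (step n)
  then show ?case using B_step[of n] assms(1) by (auto simp: prefix_def)
qed

lemma inf_prefix_iff: "inf_prefix w x \<longleftrightarrow> (\<forall>n < length w. w ! n = x !! n)"
proof
  assume "inf_prefix w x"
  then show "\<forall>n < length w. w ! n = x !! n"
    by (auto simp: inf_prefix_def)
next
  assume "\<forall>n < length w. w ! n = x !! n"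
  then have "stake (length w) x = w"
    by (intro nth_equalityI) auto
  then have "x = w @- sdrop (length w) x"
    by (metis stake_sdrop)
  then show "inf_prefix w x"
    unfolding inf_prefix_def by blast
qed

lemma ex1_b_word: "\<exists>!x. \<forall>i\<ge>1. inf_prefix (B_word i) x"
proof (rule ex_ex1I)
  have "B_word i ! n = B_word (Suc n) ! n" if "i \<ge> 1" "n < length (B_word i)" for i n
  proof (cases "i \<le> Suc n")
    case True
    then show ?thesis
      using prefix_B[of i "Suc n"] that by (auto simp: prefix_def nth_append)
  next
    case False
    then show ?thesis
      using prefix_B[of "Suc n" i] length_B_ge[of "Suc n"]
      by (auto simp: prefix_def nth_append)
  qed
  then have "\<forall>i\<ge>1. inf_prefix (B_word i) (smap (\<lambda>n. B_word (Suc n) ! n) nats)"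
    by (simp add: inf_prefix_iff)
  then show "\<exists>x. \<forall>i\<ge>1. inf_prefix (B_word i) x" by blast
next
  fix x y
  assume x: "\<forall>i\<ge>1. inf_prefix (B_word i) x" and y: "\<forall>i\<ge>1. inf_prefix (B_word i) y"
  have "x !! n = y !! n" for n
  proof -
    have "n < length (B_word (Suc n))" using length_B_ge[of "Suc n"] by simp
    then show ?thesis
      using x[rule_format, of "Suc n"] y[rule_format, of "Suc n"]
      by (simp add: inf_prefix_iff)
  qed
  then have "smap (snth x) nats = smap (snth y) nats" by presburger
  then show "x = y" by (simp add: stream_smap_nats[symmetric])
qed

lemma inf_prefix_B_b_word: "i \<ge> 1 \<Longrightarrow> inf_prefix (B_word i) b_word"
  using theI'[OF ex1_b_word] by (simp add: b_word_def)

end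

theory Submission
  imports Defs
begin

text \<open>Every \<open>B\<^sub>i\<close> ends in \<open>01\<close>, and \<open>B\<^sub>i\<close> is followed in \<open>\<^bold>b\<close> by a copy of what
  stands at position \<open>i\<close>. So a word \<open>u\<close> read at position \<open>i\<close> also occurs as \<open>1u\<close> and as
  \<open>01u\<close>, at positions where the argument can be repeated. Prepending the blocks \<open>1\<close> and \<open>01\<close>
  produces all words without \<open>00\<close> that end in \<open>1\<close>, and every word without \<open>00\<close> is a prefix
  of one of these. Conversely, no \<open>00\<close> can arise in \<open>B\<^sub>i C\<^sub>i\<close>, because \<open>B\<^sub>i\<close> ends in \<open>1\<close>.\<close>

lemma suffix_B_word:
  assumes "i \<ge> 1"
  shows "suffix [0, 1] (B_word i)"
  using assms
proof (induction i rule: nat_induct_at_least)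
  case base
  then show ?case by (simp add: suffix_def)
next
  case (Suc i)
  then obtain v where v: "B_word i = v @ [0, 1]" by (auto simp: suffix_def)
  have "i \<le> length v" using length_B_ge[OF Suc.hyps] v by simp
  then have "C_word i = drop i v @ [0, 1]" by (simp add: C_word_def v)
  then show ?case using B_step[OF Suc.hyps] by (simp add: suffix_def)
qed

lemma B_word_no_double_zero:
  assumes "i \<ge> 1"
  shows "\<not> sublist [0, 0] (B_word i)"
  using assms
proof (induction i rule: nat_induct_at_least)
  case base
  then show ?case by (simp add: sublist_Cons_right)
next
  case (Suc i)
  have C: "\<not> sublist [0, 0] (C_word i)"
    using Suc.IH sublist_drop[of i "B_word i"] unfolding C_word_def
    by (meson sublist_order.order.trans)
  obtain v where v: "B_word i = v @ [0, 1]"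
    using suffix_B_word[OF Suc.hyps] by (auto simp: suffix_def)
  show ?case
  proof
    assume "sublist [0, 0] (B_word (Suc i))"
    \<comment> \<open>An occurrence in neither factor straddles the boundary; a nonempty
      \<open>s\<close> would then make \<open>B_word i\<close> end in 0.\<close>
    then obtain s p where sp: "[0, 0] = s @ p" "suffix s (B_word i)" "prefix p (C_word i)"
      using B_step[OF Suc.hyps] Suc.IH C by (auto simp: sublist_append)
    show False
    proof (cases s rule: rev_cases)
      case Nil
      with sp C show False by auto
    next
      case (snoc s' x)
      with sp(1) have "x = 0"
        by (cases s') (auto simp: append_eq_Cons_conv Cons_eq_append_conv)
      with sp(2) snoc v show False by (auto simp: suffix_def)
    qed
  qed
qed

text \<open>Puts the final 01 of \<open>B_word i\<close> strictly beyond position \<open>i\<close>,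
  as re-indexing by its position requires. The bound fails at \<open>i = 1\<close>, whence
  \<open>i \<ge> 2\<close> from here on.\<close>

lemma length_B_ge': "i \<ge> 2 \<Longrightarrow> i + 3 \<le> length (B_word i)"
proof (induction i rule: nat_induct_at_least)
  case base
  then show ?case by (simp add: numeral_2_eq_2)
next
  case (Suc i)
  then show ?case using B_step[of i] by (simp add: C_word_def)
qed

text \<open>As \<open>i < length x\<close>, the word \<open>B_word (length x)\<close> extends
  \<open>B_word (i + 1)\<close>, which begins with \<open>x @ v @ u\<close>; dropping
  \<open>length x\<close> symbols removes exactly \<open>x\<close>.\<close>

lemma prefix_C_word_append:
  assumes "i \<ge> 1" "B_word i = x @ v" "i < length x" "prefix u (C_word i)"
  shows "prefix (v @ u) (C_word (length x))"
proof -
  obtain t where t: "C_word i = u @ t" using assms(4) by (auto simp: prefix_def)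
  have "prefix (B_word (i + 1)) (B_word (length x))"
    using assms(1,3) by (intro prefix_B) auto
  then have "prefix (x @ v @ u @ t) (B_word (length x))"
    using B_step[OF assms(1)] assms(2) t by simp
  then show ?thesis by (auto simp: C_word_def prefix_def)
qed

lemma prefix_C_word_prepend:
  assumes i: "i \<ge> 2" and u: "prefix u (C_word i)"
  shows "\<exists>j\<ge>2. prefix (1 # u) (C_word j)" "\<exists>j\<ge>2. prefix (0 # 1 # u) (C_word j)"
proof -
  obtain v where v: "B_word i = v @ [0, 1]"
    using suffix_B_word[of i] i by (auto simp: suffix_def)
  have len: "i < length v" using length_B_ge'[OF i] v by simp
  have "prefix ([0, 1] @ u) (C_word (length v))"
    using v i u len by (intro prefix_C_word_append) auto
  then show "\<exists>j\<ge>2. prefix (0 # 1 # u) (C_word j)"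
    using i len by (intro exI[of _ "length v"]) simp
  \<comment> \<open>Cutting inside the final 01 leaves only the 1 to prepend.\<close>
  have "prefix ([1] @ u) (C_word (length (v @ [0])))"
    using v i u len by (intro prefix_C_word_append) auto
  then show "\<exists>j\<ge>2. prefix (1 # u) (C_word j)"
    using i len by (intro exI[of _ "length (v @ [0])"]) simp
qed

text \<open>The final \<open>1\<close> guarantees that a \<open>0\<close> at the end of \<open>w\<close> belongs to a block \<open>01\<close>.\<close>

lemma no_double_zero_imp_prefix_C_word:
  fixes w :: "bit list"
  assumes "\<not> sublist [0, 0] w"
  shows "\<exists>i\<ge>2. prefix (w @ [1]) (C_word i)"
  using assms
proof (induction w rule: length_induct)
  case (1 w)
  have base: "prefix [1] (C_word 2)" by (simp add: C_word_def numeral_2_eq_2)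
  consider "w = []" | "w = [0]" | w' where "w = 1 # w'" | w' where "w = 0 # 1 # w'"
    using "1.prems" by (metis bit.exhaust neq_Nil_conv prefix_Cons prefix_bot.bot_least
        prefix_imp_sublist bit_not_one_iff)
  then show ?case
  proof cases
    case 1
    with base show ?thesis by auto
  next
    case 2
    with prefix_C_word_prepend(2)[of 2 "[]"] show ?thesis by simp
  next
    case (3 w')
    then have "\<exists>i\<ge>2. prefix (w' @ [1]) (C_word i)"
      using "1.IH" "1.prems" by (simp add: sublist_Cons_right)
    with 3 prefix_C_word_prepend(1) show ?thesis by auto
  next
    case (4 w')
    then have "\<exists>i\<ge>2. prefix (w' @ [1]) (C_word i)"
      using "1.IH" "1.prems" by (simp add: sublist_Cons_right)
    with 4 prefix_C_word_prepend(2) show ?thesis by auto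
  qed
qed

theorem theorem7:
  fixes w :: "bit list"
  shows "inf_factor w b_word \<longleftrightarrow> \<not> sublist [0, 0] w"
proof
  assume "inf_factor w b_word"
  then obtain u y where uy: "b_word = u @- w @- y" by (auto simp: inf_factor_def)
  \<comment> \<open>Large enough for \<open>B_word i\<close> to cover \<open>u @ w\<close>; the
    \<open>+ 1\<close> keeps the index positive when both are empty.\<close>
  define i where "i = length (u @ w) + 1"
  obtain z where z: "b_word = B_word i @- z"
    using inf_prefix_B_b_word[of i] by (auto simp: inf_prefix_def i_def)
  have len: "length (u @ w) \<le> length (B_word i)"
    using length_B_ge[of i] by (simp add: i_def)
  have "u @ w = stake (length (u @ w)) b_word"
    by (simp add: uy stake_shift)
  also have "\<dots> = take (length (u @ w)) (B_word i)"
    unfolding z using len by (simp add: stake_shift)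
  finally have "prefix (u @ w) (B_word i)" by (metis take_is_prefix)
  then have "sublist w (B_word i)" by (auto simp: prefix_def sublist_def)
  then show "\<not> sublist [0, 0] w"
    using B_word_no_double_zero[of i] by (auto simp: i_def dest: sublist_order.order.trans)
next
  assume "\<not> sublist [0, 0] w"
  then obtain i t where i: "i \<ge> 2" and t: "C_word i = w @ t"
    using no_double_zero_imp_prefix_C_word[of w] by (auto simp: prefix_def)
  obtain z where "b_word = B_word (i + 1) @- z"
    using inf_prefix_B_b_word[of "i + 1"] by (auto simp: inf_prefix_def)
  with i t have "b_word = B_word i @- w @- (t @- z)" using B_step[of i] by simp
  then show "inf_factor w b_word" unfolding inf_factor_def by blast
qed

end
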